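(* (Gauge invariance through order $l^4$.) Consider an effective field theory of gravity, electromagnetism and a real scalar in $d$ spacetime dimensions and let $\varsigma^v_{HKR}=\sum_{n=0}^{N-1}l^n\varsigma^v_n$, where each $\varsigma_n^v$ is a scalar (in $A,B,\dots$ indices) of boost weight $0$ and dimension $n$ that is a sum of terms of the form $(\partial_v^pP_1)(D^k\partial_v^{p'}P_2)\,Q$, with $k,p,p'\ge0$, $P_1,P_2\in\{K_{AB},K_A,\partial_v\phi\}$ and $Q$ a product of allowed terms (times functions of $\phi$). Then: (i) $\varsigma^v_n=0$ for $n\le3$; (ii) $\varsigma_4^v$ is a sum of terms of the form $P_1P_2N_1N_2$ or $P_1P_2\partial_rN_1$, with $P_1,P_2\in\{K_{AB},K_A,\partial_v\phi\}$ and $N_1,N_2\in\{\bar K_{AB},\bar K_A,\partial_r\phi\}$, completely contracted with $\mu^{AB}$ or $\epsilon^{A_1\dots A_{d-2}}$ and possibly multiplied by functions of $\phi$; (iii) consequently $\varsigma_n^v$, $n\le4$, is invariant on $C$ under every rescaling $v'=v/a(x^A)$, $a>0$, of the affine parameter of the horizon generators. Hence, if $s^v_{IWW}$ is gauge invariant on $C$, the entropy density $s^v_{IWW}+\varsigma^v_{HKR}$ is gauge invariant on $C$ up to and including order $l^4$, i.e. for EFTs known up to and including 6-derivative terms.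
   Context: Affinely parametrized Gaussian null coordinates $(r,v,x^A)$ near a smooth black hole horizon $\mathcal H=\{r=0\}$, $C=\{r=v=0\}$: $g=2dvdr-r^2\alpha\,dv^2-2r\beta_A\,dvdx^A+\mu_{AB}\,dx^Adx^B$, $v$ an affine parameter of the generators; $D_A$ is the Levi-Civita derivative of $\mu_{AB}$, $\epsilon_{A_1\dots A_{d-2}}$ its volume form; $K_{AB}=\frac12\partial_v\mu_{AB}$, $\bar K_{AB}=\frac12\partial_r\mu_{AB}$, $K_A=F_{vA}$, $\bar K_A=F_{rA}$, $\psi=F_{vr}$. Allowed terms: $\mu_{AB},\mu^{AB},\epsilon_{A_1\dots A_{d-2}},D^kR_{ABCD}[\mu],D^k\beta_A,D^k\partial_v^pK_{AB},D^k\partial_r^q\bar K_{AB},D^k\psi,D^kF_{AB},D^k\partial_v^pK_A,D^k\partial_r^q\bar K_A,D^k\partial_v^p\phi,D^k\partial_r^q\phi$ with $k,p,q\ge0$. Boost weight: $\beta_A,\mu_{AB},\epsilon,R_{ABCD}[\mu],\phi,F_{AB},\psi$ have weight 0; $K_{AB},K_A$ weight $+1$; $\bar K_{AB},\bar K_A$ weight $-1$; each $\partial_v$ adds 1, $\partial_r$ subtracts 1, $D_A$ adds 0; additive over products. Dimension (number of derivatives): $\alpha,\beta_A,\mu_{AB}$ have dimension $2,1,0$; $K_A,\bar K_A,\psi,F_{AB}$ dimension 1; $\phi$ and $\epsilon$ dimension 0; $K_{AB},\bar K_{AB}$ dimension 1; each $\partial_v,\partial_r,D_A$ adds 1; $\Lambda$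 and the scalar potential $V(\phi)$ have dimension 2; other functions of $\phi$ have dimension 0; additive over products. Gauge transformation: changing $v'=v/a(x^A)$ on $\mathcal H$ with $a>0$ arbitrary gives new coordinates of the same type. On $C$ the quantities transform as: $x'^A=x^A$, $\mu_{AB},\epsilon,R_{ABCD}[\mu],D_A$ invariant; $\partial_{v'}^pK'_{AB}=a^{p+1}\partial_v^pK_{AB}$, $\partial_{r'}^p\bar K'_{AB}=a^{-p-1}\partial_r^p\bar K_{AB}$, the same for $K_A,\bar K_A$; $\partial_{v'}^p\phi'=a^p\partial_v^p\phi$, $\partial_{r'}^p\phi'=a^{-p}\partial_r^p\phi$; $\beta_A'=\beta_A+2D_A\log a$. "Gauge invariant on $C$" means unchanged on $C$ under all such rescalings. $s^v_{IWW}$ denotes the Iyer-Wald-Wall entropy density of the theory and $\varsigma^v_{HKR}$ the correction terms (quadratic or higher in positive boost weight quantities) in the Hollands-Kovács-Reall-type entropy density $s^v_{IWW}+\varsigma^v_{HKR}$. *)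

theory Defs
  imports "HOL-Analysis.Analysis" "HOL-Library.Landau_Symbols"
begin

section \<open>Calculus on Euclidean space\<close>

definition dird :: "'a::euclidean_space \<Rightarrow> ('a \<Rightarrow> real) \<Rightarrow> 'a \<Rightarrow> real" where
  "dird e f p = deriv (\<lambda>t. f (p + t *\<^sub>R e)) 0"

text \<open>Infinite differentiability on an open set: all iterated directional derivatives of all
  components exist and are (Frechet) differentiable.\<close>

definition smooth_on :: "'a::euclidean_space set \<Rightarrow> ('a \<Rightarrow> 'b::euclidean_space) \<Rightarrow> bool" where
  "smooth_on W f \<longleftrightarrow> (\<forall>b\<in>Basis. \<forall>es. foldr dird es (\<lambda>p. f p \<bullet> b) differentiable_on W)"

section \<open>Fields in Gaussian null coordinates\<close>

text \<open>A point is \<open>(r, v, x)\<close>. The index type \<open>'n\<close> labels the \<open>d - 2\<close> transverse coordinates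
  (so \<open>d = CARD('n) + 2\<close>); its linear order is the numbering of the coordinates and is used only
  to orient the volume form.\<close>

type_synonym 'n xpt = "real ^ 'n"
type_synonym 'n pt = "real \<times> real \<times> 'n xpt"

text \<open>\<open>Fvr\<close>, \<open>Fv\<close>, \<open>Fr\<close>, \<open>Fab\<close> are the components \<open>F_vr\<close>, \<open>F_vA\<close>, \<open>F_rA\<close>, \<open>F_AB\<close> of the Maxwell
  field; \<open>region\<close> is the coordinate domain.\<close>

record ('n::finite) fields =
  region :: "'n pt set"
  alpha :: "'n pt \<Rightarrow> real"
  beta :: "'n pt \<Rightarrow> real ^ 'n"
  mu :: "'n pt \<Rightarrow> real ^ 'n ^ 'n"
  Fvr :: "'n pt \<Rightarrow> real"
  Fv :: "'n pt \<Rightarrow> real ^ 'n"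
  Fr :: "'n pt \<Rightarrow> real ^ 'n"
  Fab :: "'n pt \<Rightarrow> real ^ 'n ^ 'n"
  phi :: "'n pt \<Rightarrow> real"

abbreviation dr :: "('n::finite pt \<Rightarrow> real) \<Rightarrow> 'n pt \<Rightarrow> real" where
  "dr \<equiv> dird (1, 0, 0)"

abbreviation dv :: "('n::finite pt \<Rightarrow> real) \<Rightarrow> 'n pt \<Rightarrow> real" where
  "dv \<equiv> dird (0, 1, 0)"

abbreviation dx :: "'n \<Rightarrow> ('n::finite pt \<Rightarrow> real) \<Rightarrow> 'n pt \<Rightarrow> real" where
  "dx A \<equiv> dird (0, 0, axis A 1)"

fun gform :: "('n::finite) fields \<Rightarrow> 'n pt \<Rightarrow> 'n pt \<Rightarrow> 'n pt \<Rightarrow> real" where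
  "gform F (r, v, x) (Xr, Xv, Xx) (Yr, Yv, Yx) =
     Xv * Yr + Xr * Yv
     - r\<^sup>2 * alpha F (r, v, x) * Xv * Yv
     - r * ((beta F (r, v, x) \<bullet> Xx) * Yv + Xv * (beta F (r, v, x) \<bullet> Yx))
     + Xx \<bullet> (mu F (r, v, x) *v Yx)"

fun Fform :: "('n::finite) fields \<Rightarrow> 'n pt \<Rightarrow> 'n pt \<Rightarrow> 'n pt \<Rightarrow> real" where
  "Fform F p (Xr, Xv, Xx) (Yr, Yv, Yx) =
     Fvr F p * (Xv * Yr - Xr * Yv)
     + Xv * (Fv F p \<bullet> Yx) - Yv * (Fv F p \<bullet> Xx)
     + Xr * (Fr F p \<bullet> Yx) - Yr * (Fr F p \<bullet> Xx)
     + Xx \<bullet> (Fab F p *v Yx)"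

definition gnc :: "('n::finite) fields \<Rightarrow> bool" where
  "gnc F \<longleftrightarrow> open (region F) \<and>
     smooth_on (region F) (alpha F) \<and> smooth_on (region F) (beta F) \<and>
     smooth_on (region F) (mu F) \<and> smooth_on (region F) (Fvr F) \<and>
     smooth_on (region F) (Fv F) \<and> smooth_on (region F) (Fr F) \<and>
     smooth_on (region F) (Fab F) \<and> smooth_on (region F) (phi F) \<and>
     (\<forall>p\<in>region F. transpose (mu F p) = mu F p \<and> (\<forall>y. y \<noteq> 0 \<longrightarrow> y \<bullet> (mu F p *v y) > 0)) \<and>
     (\<forall>p\<in>region F. transpose (Fab F p) = - Fab F p) \<and>
     \<comment> \<open>\<open>dF = 0\<close>, on constant vector fields\<close>
     (\<forall>p\<in>region F. \<forall>X Y Z.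
        dird X (\<lambda>q. Fform F q Y Z) p + dird Y (\<lambda>q. Fform F q Z X) p
        + dird Z (\<lambda>q. Fform F q X Y) p = 0)"

definition on_horizon :: "('n::finite) fields \<Rightarrow> 'n pt set" where
  "on_horizon F = {p \<in> region F. fst p = 0}"

definition on_C :: "('n::finite) fields \<Rightarrow> 'n xpt set" where
  "on_C F = {x. (0, 0, x) \<in> region F}"

section \<open>Transverse geometry\<close>

definition mu_inv :: "('n::finite) fields \<Rightarrow> 'n pt \<Rightarrow> real ^ 'n ^ 'n" where
  "mu_inv F p = matrix_inv (mu F p)"

text \<open>\<open>christoffel F C A B p\<close> is \<open>\<Gamma>^C_AB\<close> of \<open>\<mu>\<close> at fixed \<open>r\<close> and \<open>v\<close>.\<close>

definition christoffel :: "('n::finite) fields \<Rightarrow> 'n \<Rightarrow> 'n \<Rightarrow> 'n \<Rightarrow> 'n pt \<Rightarrow> real" where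
  "christoffel F C A B p = (\<Sum>E\<in>UNIV. mu_inv F p $ C $ E *
     (dx A (\<lambda>q. mu F q $ E $ B) p + dx B (\<lambda>q. mu F q $ E $ A) p - dx E (\<lambda>q. mu F q $ A $ B) p)) / 2"

text \<open>\<open>riemann F A B C D p\<close> is \<open>R_ABCD[\<mu>]\<close>, with
  \<open>R^E_BCD = \<partial>_C \<Gamma>^E_DB - \<partial>_D \<Gamma>^E_CB + \<Gamma>^E_CG \<Gamma>^G_DB - \<Gamma>^E_DG \<Gamma>^G_CB\<close>.\<close>

definition riemann :: "('n::finite) fields \<Rightarrow> 'n \<Rightarrow> 'n \<Rightarrow> 'n \<Rightarrow> 'n \<Rightarrow> 'n pt \<Rightarrow> real" where
  "riemann F A B C D p = (\<Sum>E\<in>UNIV. mu F p $ A $ E *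
     (dx C (christoffel F E D B) p - dx D (christoffel F E C B) p
      + (\<Sum>G\<in>UNIV. christoffel F E C G p * christoffel F G D B p
                  - christoffel F E D G p * christoffel F G C B p)))"

text \<open>\<open>\<epsilon>_{A_1...A_m} = sqrt (det \<mu>) [A_1 ... A_m]\<close>; row \<open>i\<close> of the matrix is the unit vector
  of the index standing at the position of \<open>i\<close> in the order of \<open>'n\<close>.\<close>

definition vol :: "('n::{finite,linorder}) fields \<Rightarrow> 'n list \<Rightarrow> 'n pt \<Rightarrow> real" where
  "vol F is p = sqrt (det (mu F p)) * det (\<chi> i. axis (is ! card {..<i}) 1)"

text \<open>Covariant tensor fields on the transverse space are given by their components, a tensor of
  rank \<open>m\<close> being evaluated on index lists of length \<open>m\<close>. The index of \<open>D\<close> is put in front.\<close>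

type_synonym 'n tensor = "'n list \<Rightarrow> 'n pt \<Rightarrow> real"

fun covD :: "('n::finite) fields \<Rightarrow> 'n tensor \<Rightarrow> 'n tensor" where
  "covD F T [] p = 0"
| "covD F T (A # is) p = dx A (T is) p
     - (\<Sum>j<length is. \<Sum>C\<in>UNIV. christoffel F C A (is ! j) p * T (is[j := C]) p)"

definition scal :: "('n::finite pt \<Rightarrow> real) \<Rightarrow> 'n tensor" where
  "scal f is = f"

definition vect :: "('n::finite pt \<Rightarrow> real ^ 'n) \<Rightarrow> 'n tensor" where
  "vect f is p = f p $ (is ! 0)"

definition matr :: "('n::finite pt \<Rightarrow> real ^ 'n ^ 'n) \<Rightarrow> 'n tensor" where
  "matr f is p = f p $ (is ! 0) $ (is ! 1)"

definition Kten :: "('n::finite) fields \<Rightarrow> 'n tensor" where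
  "Kten F is p = dv (matr (mu F) is) p / 2"

definition Kbarten :: "('n::finite) fields \<Rightarrow> 'n tensor" where
  "Kbarten F is p = dr (matr (mu F) is) p / 2"

section \<open>Allowed terms\<close>

text \<open>The first argument \<open>k\<close> stands for \<open>D^k\<close>, the second one for the power of \<open>\<partial>_v\<close>
  (\<open>KAB\<close>, \<open>KA\<close>, \<open>PhiV\<close>) or \<open>\<partial>_r\<close> (\<open>KbarAB\<close>, \<open>KbarA\<close>, \<open>PhiR\<close>).\<close>

datatype allowed =
    Mu | MuInv | Eps | Riem nat | Beta nat
  | KAB nat nat | KbarAB nat nat | Psi nat | FAB nat
  | KA nat nat | KbarA nat nat | PhiV nat nat | PhiR nat nat

fun rank :: "nat \<Rightarrow> allowed \<Rightarrow> nat" where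
  "rank m Mu = 2"
| "rank m MuInv = 2"
| "rank m Eps = m"
| "rank m (Riem k) = k + 4"
| "rank m (Beta k) = k + 1"
| "rank m (KAB k p) = k + 2"
| "rank m (KbarAB k p) = k + 2"
| "rank m (Psi k) = k"
| "rank m (FAB k) = k + 2"
| "rank m (KA k p) = k + 1"
| "rank m (KbarA k p) = k + 1"
| "rank m (PhiV k p) = k"
| "rank m (PhiR k p) = k"

fun boost :: "allowed \<Rightarrow> int" where
  "boost (KAB k p) = 1 + int p"
| "boost (KbarAB k q) = - 1 - int q"
| "boost (KA k p) = 1 + int p"
| "boost (KbarA k q) = - 1 - int q"
| "boost (PhiV k p) = int p"
| "boost (PhiR k q) = - int q"
| "boost _ = 0"

fun dimen :: "allowed \<Rightarrow> nat" where
  "dimen Mu = 0"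
| "dimen MuInv = 0"
| "dimen Eps = 0"
| "dimen (Riem k) = 2 + k"
| "dimen (Beta k) = 1 + k"
| "dimen (KAB k p) = 1 + k + p"
| "dimen (KbarAB k q) = 1 + k + q"
| "dimen (Psi k) = 1 + k"
| "dimen (FAB k) = 1 + k"
| "dimen (KA k p) = 1 + k + p"
| "dimen (KbarA k q) = 1 + k + q"
| "dimen (PhiV k p) = k + p"
| "dimen (PhiR k q) = k + q"

text \<open>All indices are lower except those of \<open>MuInv\<close>.\<close>

fun component :: "('n::{finite,linorder}) fields \<Rightarrow> allowed \<Rightarrow> 'n tensor" where
  "component F Mu = matr (mu F)"
| "component F MuInv = matr (mu_inv F)"
| "component F Eps = vol F"
| "component F (Riem k) = (covD F ^^ k) (\<lambda>is. riemann F (is ! 0) (is ! 1) (is ! 2) (is ! 3))"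
| "component F (Beta k) = (covD F ^^ k) (vect (beta F))"
| "component F (KAB k p) = (covD F ^^ k) (\<lambda>is. (dv ^^ p) (Kten F is))"
| "component F (KbarAB k q) = (covD F ^^ k) (\<lambda>is. (dr ^^ q) (Kbarten F is))"
| "component F (Psi k) = (covD F ^^ k) (scal (Fvr F))"
| "component F (FAB k) = (covD F ^^ k) (matr (Fab F))"
| "component F (KA k p) = (covD F ^^ k) (\<lambda>is. (dv ^^ p) (vect (Fv F) is))"
| "component F (KbarA k q) = (covD F ^^ k) (\<lambda>is. (dr ^^ q) (vect (Fr F) is))"
| "component F (PhiV k p) = (covD F ^^ k) (\<lambda>is. (dv ^^ p) (scal (phi F) is))"
| "component F (PhiR k q) = (covD F ^^ k) (\<lambda>is. (dr ^^ q) (scal (phi F) is))"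

section \<open>Scalar monomials\<close>

text \<open>Scalar coefficients: a function of \<open>\<phi>\<close> of dimension 0, the cosmological constant, or the
  \<open>j\<close>-th derivative of the scalar potential (dimension 2, as for \<open>V\<close> itself). Real constants are
  \<open>Fun (\<lambda>_. c)\<close>.\<close>

datatype coupling = Fun "real \<Rightarrow> real" | Cosmo | Pot nat

fun coupling_dim :: "coupling \<Rightarrow> nat" where
  "coupling_dim (Fun f) = 0"
| "coupling_dim Cosmo = 2"
| "coupling_dim (Pot j) = 2"

fun coupling_val :: "real \<Rightarrow> (real \<Rightarrow> real) \<Rightarrow> coupling \<Rightarrow> real \<Rightarrow> real" where
  "coupling_val Lam V (Fun f) s = f s"
| "coupling_val Lam V Cosmo s = Lam"
| "coupling_val Lam V (Pot j) s = (deriv ^^ j) V s"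

text \<open>A monomial is a product of couplings and of allowed terms carrying abstract index labels.
  It is a scalar if every label occurs exactly once as an upper and once as a lower index; its
  value is then given by the summation convention.\<close>

type_synonym factor = "allowed \<times> nat list"
type_synonym monomial = "coupling list \<times> factor list"

definition lower_labels :: "factor list \<Rightarrow> nat list" where
  "lower_labels fs = concat (map snd (filter (\<lambda>f. fst f \<noteq> MuInv) fs))"

definition upper_labels :: "factor list \<Rightarrow> nat list" where
  "upper_labels fs = concat (map snd (filter (\<lambda>f. fst f = MuInv) fs))"

definition is_scalar :: "nat \<Rightarrow> monomial \<Rightarrow> bool" where
  "is_scalar m t \<longleftrightarrow> (\<forall>(T, ls) \<in> set (snd t). length ls = rank m T) \<and>
     distinct (lower_labels (snd t)) \<and> distinct (upper_labels (snd t)) \<and>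
     set (lower_labels (snd t)) = set (upper_labels (snd t))"

definition boost_weight :: "monomial \<Rightarrow> int" where
  "boost_weight t = (\<Sum>f\<leftarrow>snd t. boost (fst f))"

definition dimension :: "monomial \<Rightarrow> nat" where
  "dimension t = (\<Sum>c\<leftarrow>fst t. coupling_dim c) + (\<Sum>f\<leftarrow>snd t. dimen (fst f))"

definition monomial_val ::
  "real \<Rightarrow> (real \<Rightarrow> real) \<Rightarrow> ('n::{finite,linorder}) fields \<Rightarrow> 'n pt \<Rightarrow> monomial \<Rightarrow> real" where
  "monomial_val Lam V F p t = (\<Prod>c\<leftarrow>fst t. coupling_val Lam V c (phi F p)) *
     (\<Sum>\<sigma> \<in> Pi\<^sub>E (set (upper_labels (snd t))) (\<lambda>_. UNIV :: 'n set).
        \<Prod>(T, ls)\<leftarrow>snd t. component F T (map \<sigma> ls) p)"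

type_synonym expression = "monomial list"

definition expression_val ::
  "real \<Rightarrow> (real \<Rightarrow> real) \<Rightarrow> expression \<Rightarrow> ('n::{finite,linorder}) fields \<Rightarrow> 'n pt \<Rightarrow> real" where
  "expression_val Lam V E F p = (\<Sum>t\<leftarrow>E. monomial_val Lam V F p t)"

section \<open>The structure of the correction terms\<close>

text \<open>The allowed terms \<open>D^k \<partial>_v^p P\<close> with \<open>P\<close> one of \<open>K_AB\<close>, \<open>K_A\<close>, \<open>\<partial>_v \<phi>\<close>.\<close>

definition Pterms :: "nat \<Rightarrow> nat \<Rightarrow> allowed set" where
  "Pterms k p = {KAB k p, KA k p, PhiV k (Suc p)}"

text \<open>The allowed terms \<open>\<partial>_r^q N\<close> with \<open>N\<close> one of \<open>K-bar_AB\<close>, \<open>K-bar_A\<close>, \<open>\<partial>_r \<phi>\<close>.\<close>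

definition Nterms :: "nat \<Rightarrow> allowed set" where
  "Nterms q = {KbarAB 0 q, KbarA 0 q, PhiR 0 (Suc q)}"

text \<open>\<open>(\<partial>_v^p P1) (D^k \<partial>_v^p' P2) Q\<close>. As products commute, it is no loss of generality that the two
  distinguished factors come first.\<close>

definition quadratic_form :: "monomial \<Rightarrow> bool" where
  "quadratic_form t \<longleftrightarrow> (\<exists>cs T1 ls1 T2 ls2 Q p p' k.
     t = (cs, (T1, ls1) # (T2, ls2) # Q) \<and> T1 \<in> Pterms 0 p \<and> T2 \<in> Pterms k p')"

text \<open>\<open>m\<close> is the number of transverse dimensions.\<close>

definition hkr_expression :: "nat \<Rightarrow> nat \<Rightarrow> expression \<Rightarrow> bool" where
  "hkr_expression m n E \<longleftrightarrow> (\<forall>t\<in>set E.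
     is_scalar m t \<and> boost_weight t = 0 \<and> dimension t = n \<and> quadratic_form t)"

text \<open>\<open>f(\<phi>) P1 P2 N1 N2\<close> or \<open>f(\<phi>) P1 P2 \<partial>_r N1\<close>, completely contracted.\<close>

definition order4_form :: "nat \<Rightarrow> monomial \<Rightarrow> bool" where
  "order4_form m t \<longleftrightarrow> is_scalar m t \<and> (\<exists>cs T1 ls1 T2 ls2 Ns G.
     t = (cs, (T1, ls1) # (T2, ls2) # Ns @ G) \<and>
     set cs \<subseteq> range Fun \<and>
     T1 \<in> Pterms 0 0 \<and> T2 \<in> Pterms 0 0 \<and>
     ((\<exists>N1 N2. map fst Ns = [N1, N2] \<and> N1 \<in> Nterms 0 \<and> N2 \<in> Nterms 0) \<or>
      (\<exists>dN1. map fst Ns = [dN1] \<and> dN1 \<in> Nterms 1)) \<and>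
     fst ` set G \<subseteq> {MuInv, Eps})"

section \<open>Rescaling of the affine parameter\<close>

text \<open>\<open>F'\<close> describes the same spacetime fields as \<open>F\<close>, in coordinates adapted to \<open>v' = v / a(x)\<close>.
  The map \<open>\<Phi>\<close> expresses the old coordinates through the new ones.\<close>

definition coordinate_change ::
  "('n xpt \<Rightarrow> real) \<Rightarrow> ('n::finite) fields \<Rightarrow> 'n fields \<Rightarrow> bool" where
  "coordinate_change a F F' \<longleftrightarrow> on_C F' = on_C F \<and> (\<exists>W \<Phi>.
     open W \<and> W \<subseteq> region F' \<and> (\<forall>x\<in>on_C F'. (0, 0, x) \<in> W) \<and>
     smooth_on W \<Phi> \<and> inj_on \<Phi> W \<and> \<Phi> ` W \<subseteq> region F \<and>
     (\<forall>v x. (0, v, x) \<in> W \<longrightarrow> \<Phi> (0, v, x) = (0, a x * v, x)) \<and>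
     (\<forall>p\<in>W. \<forall>X Y.
        gform F' p X Y = gform F (\<Phi> p) (frechet_derivative \<Phi> (at p) X) (frechet_derivative \<Phi> (at p) Y) \<and>
        Fform F' p X Y = Fform F (\<Phi> p) (frechet_derivative \<Phi> (at p) X) (frechet_derivative \<Phi> (at p) Y)) \<and>
     (\<forall>p\<in>W. phi F' p = phi F (\<Phi> p)))"

text \<open>The transformation laws on \<open>C\<close>. Those for \<open>\<epsilon>\<close>, \<open>R_ABCD[\<mu>]\<close> and \<open>D_A\<close> follow from the one
  for \<open>\<mu>\<close>.\<close>

definition transformation_laws ::
  "('n xpt \<Rightarrow> real) \<Rightarrow> ('n::{finite,linorder}) fields \<Rightarrow> 'n fields \<Rightarrow> bool" where
  "transformation_laws a F F' \<longleftrightarrow> (\<forall>x\<in>on_C F. \<forall>A B p. let c = (0, 0, x) in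
     mu F' c = mu F c \<and>
     component F' (KAB 0 p) [A, B] c = a x ^ (p + 1) * component F (KAB 0 p) [A, B] c \<and>
     component F' (KA 0 p) [A] c = a x ^ (p + 1) * component F (KA 0 p) [A] c \<and>
     component F' (PhiV 0 p) [] c = a x ^ p * component F (PhiV 0 p) [] c \<and>
     component F' (KbarAB 0 p) [A, B] c = component F (KbarAB 0 p) [A, B] c / a x ^ (p + 1) \<and>
     component F' (KbarA 0 p) [A] c = component F (KbarA 0 p) [A] c / a x ^ (p + 1) \<and>
     component F' (PhiR 0 p) [] c = component F (PhiR 0 p) [] c / a x ^ p \<and>
     beta F' c $ A = beta F c $ A + 2 * dird (axis A 1) (\<lambda>y. ln (a y)) x)"

text \<open>The laws hold for every such coordinate change; they are recorded as part of the notion.\<close>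

definition rescaling ::
  "('n xpt \<Rightarrow> real) \<Rightarrow> ('n::{finite,linorder}) fields \<Rightarrow> 'n fields \<Rightarrow> bool" where
  "rescaling a F F' \<longleftrightarrow> gnc F \<and> gnc F' \<and> smooth_on (on_C F) a \<and> (\<forall>x\<in>on_C F. a x > 0) \<and>
     coordinate_change a F F' \<and> transformation_laws a F F'"

text \<open>Gauge invariance on \<open>C\<close>, over a class \<open>S\<close> of field configurations.\<close>

definition gauge_invariant_on_C ::
  "('n::{finite,linorder}) fields set \<Rightarrow> ('n fields \<Rightarrow> 'n pt \<Rightarrow> real) \<Rightarrow> bool" where
  "gauge_invariant_on_C S s \<longleftrightarrow> (\<forall>F\<in>S. \<forall>F'\<in>S. \<forall>a. rescaling a F F' \<longrightarrow>
     (\<forall>x\<in>on_C F. s F' (0, 0, x) = s F (0, 0, x)))"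

text \<open>Gauge invariance up to and including order \<open>l^M\<close>.\<close>

definition gauge_invariant_up_to ::
  "nat \<Rightarrow> ('n::{finite,linorder}) fields set \<Rightarrow> (real \<Rightarrow> 'n fields \<Rightarrow> 'n pt \<Rightarrow> real) \<Rightarrow> bool" where
  "gauge_invariant_up_to M S s \<longleftrightarrow> (\<forall>F\<in>S. \<forall>F'\<in>S. \<forall>a. rescaling a F F' \<longrightarrow>
     (\<forall>x\<in>on_C F. (\<lambda>l. s l F' (0, 0, x) - s l F (0, 0, x)) \<in> O[at_right 0](\<lambda>l. l ^ (M + 1))))"

definition hkr_correction ::
  "real \<Rightarrow> (real \<Rightarrow> real) \<Rightarrow> (nat \<Rightarrow> expression) \<Rightarrow> nat \<Rightarrow> real
     \<Rightarrow> ('n::{finite,linorder}) fields \<Rightarrow> 'n pt \<Rightarrow> real" where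
  "hkr_correction Lam V \<sigma> N l F p = (\<Sum>n<N. l ^ n * expression_val Lam V (\<sigma> n) F p)"

end

theory Submission
  imports Defs
begin

text \<open>For every allowed term the dimension plus the boost weight is nonnegative, and it is at least 2
  for the two distinguished factors of positive boost weight. Hence a term of boost weight 0 has
  dimension at least 4, and in dimension 4 every inequality is an equality: no curvature, \<open>\<beta>\<close>,
  \<open>\<psi>\<close>, \<open>F_AB\<close> and no \<open>D\<close> can occur. The remaining factors rescale homogeneously with exponent equal
  to their boost weight. For the normal form, undifferentiated \<open>\<phi>\<close> are absorbed into couplings and
  each \<open>\<mu>_AB\<close> is contracted with the \<open>\<mu>^AB\<close> carrying one of its labels.\<close>

section \<open>Labels and permutations of factors\<close>

lemma lower_labels_simps [simp]:
  "lower_labels [] = []"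
  "lower_labels ((T, ls) # fs) = (if T = MuInv then [] else ls) @ lower_labels fs"
  by (auto simp: lower_labels_def)

lemma upper_labels_simps [simp]:
  "upper_labels [] = []"
  "upper_labels ((T, ls) # fs) = (if T = MuInv then ls else []) @ upper_labels fs"
  by (auto simp: upper_labels_def)

lemma mset_concat_filter_cong:
  assumes "mset fs = mset fs'"
  shows "mset (concat (map g (filter P fs))) = mset (concat (map g (filter P fs')))"
proof -
  have *: "mset (concat (map g (filter P xs)))
      = sum_mset (image_mset (\<lambda>x. mset (g x)) (filter_mset P (mset xs)))" for xs
    by (induction xs) auto
  show ?thesis
    unfolding * assms ..
qed

lemma mset_lower_labels_cong: "mset fs = mset fs' \<Longrightarrow> mset (lower_labels fs) = mset (lower_labels fs')"
  unfolding lower_labels_def by (rule mset_concat_filter_cong)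

lemma mset_upper_labels_cong: "mset fs = mset fs' \<Longrightarrow> mset (upper_labels fs) = mset (upper_labels fs')"
  unfolding upper_labels_def by (rule mset_concat_filter_cong)

lemma is_scalar_perm:
  assumes "mset fs = mset fs'" "is_scalar m (cs, fs)"
  shows "is_scalar m (cs', fs')"
proof -
  note L = mset_lower_labels_cong[OF assms(1)] and U = mset_upper_labels_cong[OF assms(1)]
  show ?thesis
    using assms(2) mset_eq_setD[OF assms(1)] mset_eq_setD[OF L] mset_eq_setD[OF U]
      mset_eq_imp_distinct_iff[OF L] mset_eq_imp_distinct_iff[OF U]
    unfolding is_scalar_def by simp
qed

lemma monomial_val_perm:
  assumes "mset fs = mset fs'"
  shows "monomial_val Lam V F p (cs, fs) = monomial_val Lam V F p (cs, fs')"
proof -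
  have "prod_list (map h fs) = prod_list (map h fs')" for h :: "factor \<Rightarrow> real"
    using assms by (metis mset_map prod_mset_prod_list)
  then show ?thesis
    unfolding monomial_val_def by (simp add: mset_eq_setD[OF mset_upper_labels_cong[OF assms]])
qed

text \<open>Lifts a rearrangement known only for the allowed terms to the factors, each term
  carrying its labels along; the normal form prescribes the order of the terms, not of the
  labels.\<close>

lemma perm_with_projection:
  assumes "mset (map f xs) = mset ys"
  obtains zs where "mset zs = mset xs" "map f zs = ys"
proof -
  obtain \<pi> where \<pi>: "\<pi> permutes {..<length (map f xs)}" "permute_list \<pi> (map f xs) = ys"
    using mset_eq_permutation[OF assms[symmetric]] by metis
  then show ?thesis
    by (intro that[of "permute_list \<pi> xs"]) (simp_all add: permute_list_map)
qed

section \<open>Simplification of monomials\<close>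

text \<open>Isolates the sum over one label, so that a contracted pair can be summed away separately
  from all other labels.\<close>

lemma sum_PiE_insert:
  fixes g :: "('a \<Rightarrow> 'b::finite) \<Rightarrow> real"
  assumes "i \<notin> U"
  shows "(\<Sum>\<sigma>\<in>Pi\<^sub>E (insert i U) (\<lambda>_. UNIV). g \<sigma>) = (\<Sum>\<sigma>\<in>Pi\<^sub>E U (\<lambda>_. UNIV). \<Sum>y\<in>UNIV. g (\<sigma>(i := y)))"
proof -
  have inj: "inj_on (\<lambda>(y, \<sigma>). \<sigma>(i := y)) (UNIV \<times> Pi\<^sub>E U (\<lambda>_. UNIV :: 'b set))"
    using inj_combinator[OF assms, of "\<lambda>_. UNIV"] by simp
  have "(\<Sum>\<sigma>\<in>Pi\<^sub>E (insert i U) (\<lambda>_. UNIV). g \<sigma>)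
      = (\<Sum>(y, \<sigma>)\<in>UNIV \<times> Pi\<^sub>E U (\<lambda>_. UNIV). g (\<sigma>(i := y)))"
    unfolding PiE_insert_eq by (subst sum.reindex[OF inj]) (simp add: case_prod_unfold)
  also have "\<dots> = (\<Sum>y\<in>UNIV. \<Sum>\<sigma>\<in>Pi\<^sub>E U (\<lambda>_. UNIV). g (\<sigma>(i := y)))"
    by (simp add: sum.cartesian_product)
  finally show ?thesis
    by (subst sum.swap)
qed

section \<open>Symmetry and inverse of the transverse metric\<close>

lemma transpose_eq_self_nth: "transpose M = M \<Longrightarrow> M $ A $ B = M $ B $ A"
  by (drule arg_cong[of _ _ "\<lambda>N. N $ B $ A"]) (simp add: transpose_def)

lemma gnc_transpose_mu: "gnc F \<Longrightarrow> p \<in> region F \<Longrightarrow> transpose (mu F p) = mu F p"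
  unfolding gnc_def by blast

lemma gnc_mu_inv:
  assumes "gnc F" "p \<in> region F"
  shows "mu F p ** mu_inv F p = mat 1" "mu_inv F p ** mu F p = mat 1"
proof -
  have pos: "y \<noteq> 0 \<Longrightarrow> y \<bullet> (mu F p *v y) > 0" for y
    using assms unfolding gnc_def by blast
  \<comment> \<open>Positive definiteness makes the kernel of \<mu> trivial, hence \<mu>
    invertible.\<close>
  have "x = 0" if "mu F p *v x = 0" for x
    using pos[of x] that by (cases "x = 0") auto
  then have "\<exists>B. mu F p ** B = mat 1 \<and> B ** mu F p = mat 1"
    unfolding invertible_def[symmetric] invertible_left_inverse matrix_left_invertible_ker by blast
  \<comment> \<open>\<open>matrix_inv\<close> is a Hilbert choice, so both identities follow once a
    two-sided inverse exists.\<close>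
  from someI_ex[OF this] show "mu F p ** mu_inv F p = mat 1" "mu_inv F p ** mu F p = mat 1"
    unfolding mu_inv_def matrix_inv_def by blast+
qed

lemma gnc_transpose_mu_inv:
  assumes "gnc F" "p \<in> region F"
  shows "transpose (mu_inv F p) = mu_inv F p"
proof -
  have "transpose (mu_inv F p) ** mu F p = transpose (mu F p ** mu_inv F p)"
    by (simp add: matrix_transpose_mul gnc_transpose_mu[OF assms])
  then have "transpose (mu_inv F p) ** mu F p = mat 1"
    by (simp add: gnc_mu_inv[OF assms] transpose_mat)
  then have "transpose (mu_inv F p) ** (mu F p ** mu_inv F p) = mu_inv F p"
    by (simp add: matrix_mul_assoc)
  then show ?thesis
    by (simp add: gnc_mu_inv[OF assms])
qed

lemmas gnc_mu_sym = transpose_eq_self_nth[OF gnc_transpose_mu]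
  and gnc_mu_inv_sym = transpose_eq_self_nth[OF gnc_transpose_mu_inv]

text \<open>Summing over the first index of both matrices is the pattern in which a shared label
  appears below; symmetry of \<mu> turns it into a matrix product.\<close>

lemma gnc_mu_contract:
  assumes "gnc F" "p \<in> region F"
  shows "(\<Sum>y\<in>UNIV. mu F p $ y $ B * mu_inv F p $ y $ C) = (if B = C then 1 else 0)"
proof -
  have "(\<Sum>y\<in>UNIV. mu F p $ y $ B * mu_inv F p $ y $ C) = (mu F p ** mu_inv F p) $ B $ C"
    by (simp add: matrix_matrix_mult_def gnc_mu_sym[OF assms, of _ B])
  then show ?thesis
    by (simp add: gnc_mu_inv[OF assms] mat_def)
qed

text \<open>The summand of the summation convention. The assignment of index values to labels is
  total, so that it can be updated at any label.\<close>

definition factor_prod :: "('n::{finite,linorder}) fields \<Rightarrow> 'n pt \<Rightarrow> (nat \<Rightarrow> 'n) \<Rightarrow> factor list \<Rightarrow> real" where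
  "factor_prod F p \<sigma> fs = (\<Prod>(T, ls)\<leftarrow>fs. component F T (map \<sigma> ls) p)"

lemma factor_prod_Cons [simp]:
  "factor_prod F p \<sigma> ((T, ls) # fs) = component F T (map \<sigma> ls) p * factor_prod F p \<sigma> fs"
  by (simp add: factor_prod_def)

lemma monomial_val_factor_prod:
  "monomial_val Lam V F p (cs, fs) = (\<Prod>c\<leftarrow>cs. coupling_val Lam V c (phi F p)) *
     (\<Sum>\<sigma> \<in> Pi\<^sub>E (set (upper_labels fs)) (\<lambda>_. UNIV). factor_prod F p \<sigma> fs)"
  by (simp add: monomial_val_def factor_prod_def)

lemma factor_prod_cong:
  assumes "\<And>i. i \<in> set (lower_labels fs) \<union> set (upper_labels fs) \<Longrightarrow> \<sigma> i = \<tau> i"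
  shows "factor_prod F p \<sigma> fs = factor_prod F p \<tau> fs"
  using assms
proof (induction fs)
  case (Cons f fs)
  obtain T ls where f: "f = (T, ls)" by fastforce
  have "map \<sigma> ls = map \<tau> ls"
    using Cons.prems by (auto simp: f split: if_splits)
  moreover have "factor_prod F p \<sigma> fs = factor_prod F p \<tau> fs"
    using Cons.prems by (intro Cons.IH) (auto simp: f)
  ultimately show ?case
    unfolding f factor_prod_Cons by (rule arg_cong2[of _ _ _ _ "(*)", OF arg_cong])
qed (simp add: factor_prod_def)

text \<open>Allowed terms of dimension 0 carry no derivatives; simplification may drop them or turn them
  into functions of \<open>\<phi>\<close>, but leaves all others in place.\<close>

definition simplifies_to :: "'n::{finite,linorder} itself \<Rightarrow> monomial \<Rightarrow> monomial \<Rightarrow> bool" where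
  "simplifies_to _ t t' \<longleftrightarrow> is_scalar CARD('n) t' \<and> set (fst t') \<subseteq> set (fst t) \<union> range Fun \<and>
     {#T \<in># mset (map fst (snd t')). dimen T \<noteq> 0#} = {#T \<in># mset (map fst (snd t)). dimen T \<noteq> 0#} \<and>
     (\<forall>Lam V (F :: 'n fields) p. gnc F \<longrightarrow> p \<in> region F \<longrightarrow>
        monomial_val Lam V F p t' = monomial_val Lam V F p t)"

lemma simplifies_to_trans:
  "simplifies_to TYPE('n) t t' \<Longrightarrow> simplifies_to TYPE('n::{finite,linorder}) t' t'' \<Longrightarrow> simplifies_to TYPE('n) t t''"
  unfolding simplifies_to_def by auto

lemma simplifies_to_perm:
  assumes "is_scalar CARD('n) (cs, fs)" "mset fs = mset fs'"
  shows "simplifies_to TYPE('n::{finite,linorder}) (cs, fs) (cs, fs')"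
  unfolding simplifies_to_def
  using is_scalar_perm[OF assms(2,1)]
  by (simp add: assms(2) monomial_val_perm[OF assms(2)])

text \<open>An undifferentiated \<phi> has rank 0 and hence no labels, so it can be pulled out of
  the index sum as the coupling given by the identity function.\<close>

lemma simplifies_to_scalar:
  assumes "is_scalar CARD('n) (cs, (T, ls) # fs)" "T \<in> {PhiV 0 0, PhiR 0 0}"
  shows "simplifies_to TYPE('n::{finite,linorder}) (cs, (T, ls) # fs) (Fun (\<lambda>s. s) # cs, fs)"
proof -
  have "ls = []"
    using assms by (auto simp: is_scalar_def)
  then show ?thesis
    using assms unfolding simplifies_to_def
    by (auto simp: is_scalar_def monomial_val_factor_prod scal_def sum_distrib_left algebra_simps)
qed

text \<open>If both labels of \<mu> sit on the same inverse metric, the pair is the trace of the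
  identity; the resulting number of transverse dimensions is stored as a constant coupling.\<close>

lemma simplifies_to_trace:
  assumes sc: "is_scalar CARD('n) (cs, (Mu, [i, j]) # (MuInv, ls) # fs)" and ls: "ls = [i, j] \<or> ls = [j, i]"
  shows "simplifies_to TYPE('n::{finite,linorder}) (cs, (Mu, [i, j]) # (MuInv, ls) # fs)
    (Fun (\<lambda>_. real CARD('n)) # cs, fs)"
proof -
  let ?U = "set (upper_labels fs)"
  have ij: "i \<noteq> j" "i \<notin> ?U" "j \<notin> ?U" "i \<notin> set (lower_labels fs)" "j \<notin> set (lower_labels fs)"
    using sc ls by (auto simp: is_scalar_def)
  have "is_scalar CARD('n) (Fun (\<lambda>_. real CARD('n)) # cs, fs)"
    using sc ls ij unfolding is_scalar_def by auto
  moreover have "(\<Sum>\<sigma>\<in>Pi\<^sub>E (insert i (insert j ?U)) (\<lambda>_. UNIV). factor_prod F p \<sigma> ((Mu, [i, j]) # (MuInv, ls) # fs))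
      = real CARD('n) * (\<Sum>\<sigma>\<in>Pi\<^sub>E ?U (\<lambda>_. UNIV). factor_prod F p \<sigma> fs)"
    if F: "gnc F" "p \<in> region F" for F :: "'n fields" and p
  proof -
    \<comment> \<open>Each label occurs once up and once down, so the metric pair uses up i and j
      and the remaining factors do not see them.\<close>
    have fp: "factor_prod F p (\<sigma>(j := b, i := a)) fs = factor_prod F p \<sigma> fs" for \<sigma> a b
      using ij by (intro factor_prod_cong) auto
    have "factor_prod F p (\<sigma>(j := b, i := a)) ((Mu, [i, j]) # (MuInv, ls) # fs)
        = mu F p $ a $ b * mu_inv F p $ a $ b * factor_prod F p \<sigma> fs" for \<sigma> a b
      using ls ij(1) by (auto simp: matr_def fp gnc_mu_inv_sym[OF F, of b a])
    then show ?thesis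
      using ij by (simp add: sum_PiE_insert gnc_mu_contract[OF F] sum_distrib_left flip: sum_distrib_right del: factor_prod_Cons)
  qed
  moreover have "set (upper_labels ((Mu, [i, j]) # (MuInv, ls) # fs)) = insert i (insert j ?U)"
    using ls by auto
  ultimately show ?thesis
    unfolding simplifies_to_def by (simp add: monomial_val_factor_prod del: factor_prod_Cons)
qed

section \<open>Contraction of the metric with an inverse metric\<close>

definition relabel :: "nat \<Rightarrow> nat \<Rightarrow> factor list \<Rightarrow> factor list" where
  "relabel j k = map (\<lambda>(T, ls). (T, map (id(j := k)) ls))"

lemma labels_relabel:
  "lower_labels (relabel j k fs) = map (id(j := k)) (lower_labels fs)"
  "upper_labels (relabel j k fs) = map (id(j := k)) (upper_labels fs)"
  unfolding relabel_def by (induction fs) auto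

text \<open>Moves the renaming from the labels into the assignment, where it can be matched with the
  value that a Kronecker delta selects.\<close>

lemma factor_prod_relabel: "factor_prod F p \<sigma> (relabel j k fs) = factor_prod F p (\<sigma>(j := \<sigma> k)) fs"
proof (induction fs)
  case (Cons f fs)
  obtain T ls where f: "f = (T, ls)" by fastforce
  have "map \<sigma> (map (id(j := k)) ls) = map (\<sigma>(j := \<sigma> k)) ls"
    by simp
  moreover have "relabel j k (f # fs) = (T, map (id(j := k)) ls) # relabel j k fs"
    by (simp add: f relabel_def)
  ultimately show ?case
    unfolding f by (simp only: factor_prod_Cons Cons.IH)
qed (simp add: factor_prod_def relabel_def)

text \<open>The pair is a Kronecker delta in j and k. The partner of j is an upper label and that of
  k a lower label in the remaining factors, so renaming j to k joins the two partners.\<close>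

lemma simplifies_to_contract:
  assumes sc: "is_scalar CARD('n) (cs, (Mu, [i, j]) # (MuInv, ls) # fs)"
    and ls: "ls = [i, k] \<or> ls = [k, i]" and kj: "k \<noteq> j"
  shows "simplifies_to TYPE('n::{finite,linorder}) (cs, (Mu, [i, j]) # (MuInv, ls) # fs) (cs, relabel j k fs)"
proof -
  let ?Up = "set (upper_labels fs)" and ?Lo = "set (lower_labels fs)"
  define U where "U = ?Up \<inter> ?Lo"
  have ijk: "i \<noteq> j" "i \<noteq> k" "i \<notin> ?Up" "k \<notin> ?Up" "i \<notin> ?Lo" "j \<notin> ?Lo"
    using sc ls by (auto simp: is_scalar_def)
  have "insert i (insert j ?Lo) = insert i (insert k ?Up)"
    using sc ls by (auto simp: is_scalar_def)
  then have Up: "?Up = insert j (?Lo - {k})" and k: "k \<in> ?Lo"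
    using ijk kj by auto
  have Up': "set (upper_labels (relabel j k fs)) = ?Lo"
    using ijk k by (auto simp: labels_relabel Up)
  have Lo': "lower_labels (relabel j k fs) = lower_labels fs"
    using ijk by (auto simp: labels_relabel intro!: map_idI)
  \<comment> \<open>Since k is no upper label of \<open>fs\<close>, the renaming identifies no two
    upper labels.\<close>
  have "inj_on (id(j := k)) ?Up"
    using ijk by (auto simp: inj_on_def)
  then have "is_scalar CARD('n) (cs, relabel j k fs)"
    using sc Up' Lo' unfolding is_scalar_def
    by (auto simp: labels_relabel distinct_map) (auto simp: relabel_def)
  moreover have "(\<Sum>\<sigma>\<in>Pi\<^sub>E (insert i (insert j ?Lo)) (\<lambda>_. UNIV). factor_prod F p \<sigma> ((Mu, [i, j]) # (MuInv, ls) # fs))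
      = (\<Sum>\<sigma>\<in>Pi\<^sub>E ?Lo (\<lambda>_. UNIV). factor_prod F p \<sigma> (relabel j k fs))"
    if F: "gnc F" "p \<in> region F" for F :: "'n fields" and p
  proof -
    have fp: "factor_prod F p (\<sigma>(j := b, i := a)) fs = factor_prod F p (\<sigma>(j := b)) fs" for \<sigma> a b
      using ijk by (intro factor_prod_cong) auto
    have "factor_prod F p (\<sigma>(j := b, i := a)) ((Mu, [i, j]) # (MuInv, ls) # fs)
        = mu F p $ a $ b * mu_inv F p $ a $ \<sigma> k * factor_prod F p (\<sigma>(j := b)) fs" for \<sigma> a b
      using ls ijk kj by (auto simp: matr_def fp gnc_mu_inv_sym[OF F, of "\<sigma> k" a])
    \<comment> \<open>The sum over the value a of i produces the delta; the sum over the value b of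
      j then keeps only b = \<open>\<sigma> k\<close>.\<close>
    then have "(\<Sum>b\<in>UNIV. \<Sum>a\<in>UNIV. factor_prod F p (\<sigma>(j := b, i := a)) ((Mu, [i, j]) # (MuInv, ls) # fs))
        = (\<Sum>b\<in>UNIV. (if b = \<sigma> k then 1 else 0) * factor_prod F p (\<sigma>(j := b)) fs)" for \<sigma>
      by (simp add: gnc_mu_contract[OF F] flip: sum_distrib_right del: factor_prod_Cons)
    moreover have "(\<Sum>b\<in>UNIV. (if b = \<sigma> k then 1 else 0) * factor_prod F p (\<sigma>(j := b)) fs)
        = factor_prod F p \<sigma> (relabel j k fs)" for \<sigma>
      by (subst sum.remove[of _ "\<sigma> k"]) (auto simp: factor_prod_relabel intro!: sum.neutral)
    ultimately show ?thesis
      using ijk by (simp add: sum_PiE_insert del: factor_prod_Cons)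
  qed
  moreover have "set (upper_labels ((Mu, [i, j]) # (MuInv, ls) # fs)) = insert i (insert j ?Lo)"
    using ls k by (auto simp: Up)
  moreover have "map fst (relabel j k fs) = map fst fs"
    by (auto simp: relabel_def)
  then have "image_mset fst (mset (relabel j k fs)) = image_mset fst (mset fs)"
    by (metis mset_map)
  ultimately show ?thesis
    unfolding simplifies_to_def by (simp add: monomial_val_factor_prod Up' del: factor_prod_Cons)
qed

text \<open>The terms to remove are \<mu> and an undifferentiated \<phi>, written
  \<open>PhiV 0 0\<close> or \<open>PhiR 0 0\<close>. Every move deletes at least one factor, which
  makes the normalization terminate.\<close>

lemma simplifies_to_step:
  assumes sc: "is_scalar CARD('n) (cs, fs)" and T: "T \<in> fst ` set fs" "dimen T = 0" "T \<notin> {MuInv, Eps}"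
  shows "\<exists>cs' fs'. simplifies_to TYPE('n::{finite,linorder}) (cs, fs) (cs', fs') \<and> length fs' < length fs"
proof -
  obtain ls where ls: "(T, ls) \<in> set fs"
    using T by auto
  obtain R where R: "mset fs = mset ((T, ls) # R)"
    using ls by (metis mset.simps(2) mset_remove1 insert_DiffM set_mset_mset)
  have scR: "is_scalar CARD('n) (cs, (T, ls) # R)"
    using is_scalar_perm[OF R sc] .
  have len: "length fs = Suc (length R)"
    using mset_eq_length[OF R] by simp
  consider "T \<in> {PhiV 0 0, PhiR 0 0}" | "T = Mu"
    using T(2,3) by (cases T) auto
  then show ?thesis
  proof cases
    case 1
    show ?thesis
      using simplifies_to_trans[OF simplifies_to_perm[OF sc R] simplifies_to_scalar[OF scR 1]] len by auto
  next
    case 2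
    have "length ls = 2"
      using scR 2 by (auto simp: is_scalar_def)
    then obtain i j where ij: "ls = [i, j]"
      by (auto simp: numeral_2_eq_2 length_Suc_conv)
    \<comment> \<open>Upper labels occur only on \<open>MuInv\<close>, so the first label of \<mu>
      always meets an inverse metric.\<close>
    have "i \<in> set (upper_labels R)"
      using scR 2 ij by (auto simp: is_scalar_def)
    then obtain ms where ms: "(MuInv, ms) \<in> set R" "i \<in> set ms"
      by (auto simp: upper_labels_def)
    then obtain R' where R': "mset R = mset ((MuInv, ms) # R')"
      by (metis mset.simps(2) mset_remove1 insert_DiffM set_mset_mset)
    have perm: "mset fs = mset ((Mu, [i, j]) # (MuInv, ms) # R')"
      using R R' 2 ij by simp
    note scR' = is_scalar_perm[OF perm sc]
    have "length ms = 2"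
      using scR' by (auto simp: is_scalar_def)
    then obtain k where k: "ms = [i, k] \<or> ms = [k, i]"
      using ms(2) by (fastforce simp: numeral_2_eq_2 length_Suc_conv)
    have len': "length R' < length fs" "length (relabel j k R') < length fs"
      using mset_eq_length[OF perm] by (auto simp: relabel_def)
    show ?thesis
    proof (cases "k = j")
      case True
      then show ?thesis
        using simplifies_to_trans[OF simplifies_to_perm[OF sc perm] simplifies_to_trace[OF scR']] k len' by blast
    next
      case False
      then show ?thesis
        using simplifies_to_trans[OF simplifies_to_perm[OF sc perm] simplifies_to_contract[OF scR' k]] len' by blast
    qed
  qed
qed

lemma simplifies_to_normal:
  assumes "is_scalar CARD('n) (cs, fs)"
  shows "\<exists>cs' fs'. simplifies_to TYPE('n::{finite,linorder}) (cs, fs) (cs', fs') \<and>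
    (\<forall>T \<in> fst ` set fs'. dimen T = 0 \<longrightarrow> T \<in> {MuInv, Eps})"
  using assms
proof (induction "length fs" arbitrary: cs fs rule: less_induct)
  case less
  show ?case
  proof (cases "\<forall>T \<in> fst ` set fs. dimen T = 0 \<longrightarrow> T \<in> {MuInv, Eps}")
    case True
    then show ?thesis
      \<comment> \<open>The trivial permutation serves as reflexivity of
        \<open>simplifies_to\<close>.\<close>
      using simplifies_to_perm[OF less.prems refl] by blast
  next
    case False
    then obtain cs1 fs1 where 1: "simplifies_to TYPE('n) (cs, fs) (cs1, fs1)" "length fs1 < length fs"
      using simplifies_to_step[OF less.prems] by blast
    then have "is_scalar CARD('n) (cs1, fs1)"
      by (simp add: simplifies_to_def)
    then show ?thesis
      using less.hyps[OF 1(2)] simplifies_to_trans[OF 1(1)] by blast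
  qed
qed

section \<open>Counting dimensions and boost weights\<close>

text \<open>This count is blind to \<partial>_r, which changes dimension and boost weight
  oppositely, while \<partial>_v contributes 2 and D contributes 1.\<close>

definition excess :: "allowed \<Rightarrow> int" where
  "excess T = int (dimen T) + boost T"

lemma excess_nonneg: "excess T \<ge> 0"
  by (cases T) (auto simp: excess_def)

lemma excess_Pterms: "T \<in> Pterms k p \<Longrightarrow> excess T = 2 + 2 * int p + int k"
  by (auto simp: Pterms_def excess_def)

lemma excess_sum:
  "int (dimension t) + boost_weight t = int (\<Sum>c\<leftarrow>fst t. coupling_dim c) + (\<Sum>f\<leftarrow>snd t. excess (fst f))"
proof -
  have "int (\<Sum>f\<leftarrow>fs. dimen (fst f)) + (\<Sum>f\<leftarrow>fs. boost (fst f)) = (\<Sum>f\<leftarrow>fs. excess (fst f))" for fs :: "factor list"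
    by (induction fs) (auto simp: excess_def)
  from this[of "snd t"] show ?thesis
    by (simp add: dimension_def boost_weight_def)
qed

lemma hkr_dimension_ge_4:
  assumes "boost_weight t = 0" "quadratic_form t"
  shows "dimension t \<ge> 4"
proof -
  obtain cs T1 ls1 T2 ls2 Q p p' k where t: "t = (cs, (T1, ls1) # (T2, ls2) # Q)"
    and "T1 \<in> Pterms 0 p" "T2 \<in> Pterms k p'"
    using assms(2) unfolding quadratic_form_def by blast
  moreover have "(\<Sum>f\<leftarrow>Q. excess (fst f)) \<ge> 0"
    by (intro sum_list_nonneg) (auto simp: excess_nonneg)
  ultimately show ?thesis
    using excess_sum[of t] assms(1) by (simp add: excess_Pterms)
qed

lemma hkr_dimension_4:
  assumes "boost_weight t = 0" "quadratic_form t" "dimension t = 4"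
  obtains cs T1 ls1 T2 ls2 Q where "t = (cs, (T1, ls1) # (T2, ls2) # Q)" "T1 \<in> Pterms 0 0" "T2 \<in> Pterms 0 0"
    "set cs \<subseteq> range Fun" "\<And>f. f \<in> set Q \<Longrightarrow> excess (fst f) = 0" "(\<Sum>f\<leftarrow>Q. dimen (fst f)) = 2"
proof -
  obtain cs T1 ls1 T2 ls2 Q p p' k where t: "t = (cs, (T1, ls1) # (T2, ls2) # Q)"
    and P: "T1 \<in> Pterms 0 p" "T2 \<in> Pterms k p'"
    using assms(2) unfolding quadratic_form_def by blast
  have Q: "(\<Sum>f\<leftarrow>Q. excess (fst f)) \<ge> 0"
    by (intro sum_list_nonneg) (auto simp: excess_nonneg)
  have eq: "int (\<Sum>c\<leftarrow>cs. coupling_dim c) + (4 + 2 * int p + 2 * int p' + int k)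
      + (\<Sum>f\<leftarrow>Q. excess (fst f)) = 4"
    using excess_sum[of t] assms P by (simp add: t excess_Pterms)
  \<comment> \<open>The two distinguished factors already use up the 4, so every other summand,
    being nonnegative, vanishes.\<close>
  from eq Q have z: "p = 0" "p' = 0" "k = 0" "(\<Sum>f\<leftarrow>Q. excess (fst f)) = 0" "(\<Sum>c\<leftarrow>cs. coupling_dim c) = 0"
    by linarith+
  have cd: "coupling_dim c = 0" if "c \<in> set cs" for c
    using z(5) that by (metis sum_list_eq_0_iff image_eqI set_map)
  have "set cs \<subseteq> range Fun"
  proof
    fix c assume "c \<in> set cs"
    then show "c \<in> range Fun"
      using cd[of c] by (cases c rule: coupling.exhaust) auto
  qed
  moreover have "excess (fst f) = 0" if "f \<in> set Q" for f
    using z(4) that by (subst (asm) sum_list_nonneg_eq_0_iff) (auto simp: excess_nonneg)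
  \<comment> \<open>The distinguished factors have dimension 1 each and the couplings 0, which
    leaves 2 of the 4.\<close>
  moreover have "(\<Sum>f\<leftarrow>Q. dimen (fst f)) = 2"
    using assms(3) P z by (auto simp: t dimension_def Pterms_def)
  ultimately show ?thesis
    using that t P z by blast
qed

text \<open>Curvature, \<beta>, \<psi>, \<open>F_AB\<close>, any D and all terms of positive boost
  weight have positive excess. The shift by one is the dimension of N itself.\<close>

lemma excess_0_Nterms: "excess T = 0 \<Longrightarrow> dimen T = Suc q \<Longrightarrow> T \<in> Nterms q"
  by (cases T) (auto simp: excess_def Nterms_def)

text \<open>The splittings 2 and 1 + 1 give the two shapes \<partial>_r N1 and N1 N2.\<close>

lemma sum_list_eq_2_cases:
  assumes "(\<Sum>x\<leftarrow>xs. f x) = (2::nat)" "\<And>x. x \<in> set xs \<Longrightarrow> f x \<noteq> 0"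
  shows "(\<exists>x. xs = [x] \<and> f x = 2) \<or> (\<exists>x y. xs = [x, y] \<and> f x = 1 \<and> f y = 1)"
proof (cases xs)
  case (Cons x ys)
  note xs = Cons
  show ?thesis
  proof (cases ys)
    case (Cons y zs)
    have "f x \<noteq> 0" "f y \<noteq> 0"
      using assms(2) xs Cons by auto
    with assms(1) have "f x = 1" "f y = 1" "(\<Sum>x\<leftarrow>zs. f x) = 0"
      unfolding xs Cons list.map sum_list.Cons by linarith+
    then show ?thesis
      using assms(2) xs Cons by (cases zs) auto
  qed (use assms xs in auto)
qed (use assms in auto)

lemma order4_form_exists:
  assumes "is_scalar CARD('n) t" "boost_weight t = 0" "dimension t = 4" "quadratic_form t"
  shows "\<exists>t'. order4_form CARD('n::{finite,linorder}) t' \<and>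
    (\<forall>Lam V (F :: 'n fields) p. gnc F \<longrightarrow> p \<in> region F \<longrightarrow>
       monomial_val Lam V F p t' = monomial_val Lam V F p t)"
proof -
  obtain cs T1 ls1 T2 ls2 Q where t: "t = (cs, (T1, ls1) # (T2, ls2) # Q)"
    and P: "T1 \<in> Pterms 0 0" "T2 \<in> Pterms 0 0"
    and cs: "set cs \<subseteq> range Fun" and Q: "\<And>f. f \<in> set Q \<Longrightarrow> excess (fst f) = 0"
    and Q2: "(\<Sum>f\<leftarrow>Q. dimen (fst f)) = 2"
    using hkr_dimension_4[OF assms(2,4,3)] by metis
  obtain cs' fs where s: "simplifies_to TYPE('n) t (cs', fs)"
    and fs: "\<forall>T \<in> fst ` set fs. dimen T = 0 \<longrightarrow> T \<in> {MuInv, Eps}"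
    using simplifies_to_normal assms(1) unfolding t by blast
  \<comment> \<open>\<open>Ns\<close> is read off the original monomial, where the excess is known,
    and \<open>G\<close> off the simplified one, where the terms of dimension 0 are controlled.
    Simplification preserves all terms of nonzero dimension, so the two fit together.\<close>
  define Ns where "Ns = filter (\<lambda>T. dimen T \<noteq> 0) (map fst Q)"
  define G where "G = filter (\<lambda>T. dimen T = 0) (map fst fs)"
  have "mset (map fst fs) = {#T \<in># mset (map fst fs). dimen T \<noteq> 0#} + mset G"
    unfolding G_def mset_filter using multiset_partition[of "mset (map fst fs)" "\<lambda>T. dimen T \<noteq> 0"] by simp
  also have "{#T \<in># mset (map fst fs). dimen T \<noteq> 0#} = mset (T1 # T2 # Ns)"
    using s P unfolding simplifies_to_def t Ns_def by (auto simp: Pterms_def simp flip: mset_map mset_filter)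
  finally have "mset (map fst fs) = mset (T1 # T2 # Ns @ G)"
    by simp
  then obtain fs' where fs': "mset fs' = mset fs" "map fst fs' = T1 # T2 # Ns @ G"
    by (rule perm_with_projection)
  then obtain k1 k2 R where R: "fs' = (T1, k1) # (T2, k2) # R" "map fst R = Ns @ G"
    by (auto simp: map_eq_Cons_conv)
  then obtain Nf Gf where NG: "R = Nf @ Gf" "map fst Nf = Ns" "map fst Gf = G"
    by (auto simp: map_eq_append_conv)
  have sum: "(\<Sum>T\<leftarrow>Ns. dimen T) = 2"
  proof -
    have "(\<Sum>T\<leftarrow>filter (\<lambda>T. dimen T \<noteq> 0) xs. dimen T) = (\<Sum>T\<leftarrow>xs. dimen T)" for xs
      by (induction xs) auto
    then show ?thesis
      using Q2 by (simp add: Ns_def o_def)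
  qed
  have N: "T \<in> Nterms q" if "T \<in> set Ns" "dimen T = Suc q" for T q
    using that Q by (intro excess_0_Nterms) (auto simp: Ns_def)
  have "(\<exists>x. Ns = [x] \<and> dimen x = 2) \<or> (\<exists>x y. Ns = [x, y] \<and> dimen x = 1 \<and> dimen y = 1)"
    using sum by (rule sum_list_eq_2_cases) (auto simp: Ns_def)
  then have N: "(\<exists>N1 N2. Ns = [N1, N2] \<and> N1 \<in> Nterms 0 \<and> N2 \<in> Nterms 0) \<or> (\<exists>dN1. Ns = [dN1] \<and> dN1 \<in> Nterms 1)"
    using N by (elim disjE exE conjE) simp_all
  have "set cs' \<subseteq> range Fun"
    using s cs by (auto simp: simplifies_to_def t)
  moreover have sc: "is_scalar CARD('n) (cs', fs)"
    using s by (simp add: simplifies_to_def)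
  moreover have "fst ` set Gf \<subseteq> {MuInv, Eps}"
    using fs arg_cong[OF NG(3), of set] by (auto simp: G_def)
  ultimately have "order4_form CARD('n) (cs', fs')"
    unfolding order4_form_def R(1) NG(1)
    using is_scalar_perm[OF fs'(1)[symmetric] sc] P N NG(2) unfolding R(1) NG(1)
    by (intro conjI exI[of _ cs'] exI[of _ T1] exI[of _ k1] exI[of _ T2] exI[of _ k2]
        exI[of _ Nf] exI[of _ Gf]) simp_all
  moreover have "\<forall>Lam V (F :: 'n fields) p. gnc F \<longrightarrow> p \<in> region F \<longrightarrow>
       monomial_val Lam V F p (cs', fs') = monomial_val Lam V F p t"
    unfolding monomial_val_perm[OF fs'(1)] using s by (simp add: simplifies_to_def)
  ultimately show ?thesis
    by blast
qed

section \<open>Behaviour under rescalings\<close>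

text \<open>The condition on \<open>T\<close> excludes \<beta>, whose law is inhomogeneous, and
  every D, which would differentiate the powers of a. The laws that remain are homogeneous.\<close>

lemma component_rescaling:
  fixes F F' :: "('n::{finite,linorder}) fields"
  assumes tr: "transformation_laws a F F'" and x: "x \<in> on_C F" and pos: "a x > 0"
    and T: "T \<in> Pterms 0 0 \<or> excess T = 0" and len: "length is = rank CARD('n) T"
  shows "component F' T is (0, 0, x) = a x powi boost T * component F T is (0, 0, x)"
proof -
  let ?c = "(0, 0, x) :: 'n pt"
  have neg: "a x powi (- 1 - int q) = 1 / a x ^ (q + 1)" for q
    by (simp add: power_int_def field_simps nat_add_distrib)
  have neg0: "a x powi (- int q) = 1 / a x ^ q" for q
    by (simp add: power_int_minus divide_inverse)
  have laws: "mu F' ?c = mu F ?c"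
    "component F' (KAB 0 p) [A, B] ?c = a x ^ (p + 1) * component F (KAB 0 p) [A, B] ?c"
    "component F' (KA 0 p) [A] ?c = a x ^ (p + 1) * component F (KA 0 p) [A] ?c"
    "component F' (PhiV 0 p) [] ?c = a x ^ p * component F (PhiV 0 p) [] ?c"
    "component F' (KbarAB 0 p) [A, B] ?c = component F (KbarAB 0 p) [A, B] ?c / a x ^ (p + 1)"
    "component F' (KbarA 0 p) [A] ?c = component F (KbarA 0 p) [A] ?c / a x ^ (p + 1)"
    "component F' (PhiR 0 p) [] ?c = component F (PhiR 0 p) [] ?c / a x ^ p" for A B p
    using tr x unfolding transformation_laws_def Let_def by blast+
  note laws = laws(1) laws(2-)[unfolded component.simps funpow.simps id_apply]
  consider "T \<in> {Mu, MuInv, Eps, PhiV 0 0}" | "T = KAB 0 0" | "T = KA 0 0" | "T = PhiV 0 1"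
    | q where "T = KbarAB 0 q" | q where "T = KbarA 0 q" | q where "T = PhiR 0 q"
    using T by (cases T) (auto simp: excess_def Pterms_def)
  then show ?thesis
  proof cases
    case 1
    \<comment> \<open>The inverse metric and the volume form are pointwise functions of \<mu>, and
      \<phi> is the case p = 0 of its law.\<close>
    then show ?thesis
      using laws(1) laws(4)[of 0] len by (auto simp: matr_def mu_inv_def vol_def)
  next
    case 2
    then obtain A B where "is = [A, B]"
      using len by (auto simp: numeral_2_eq_2 length_Suc_conv)
    then show ?thesis using laws(2)[of 0 A B] 2 by simp
  next
    case 3
    then obtain A where "is = [A]"
      using len by (auto simp: length_Suc_conv)
    then show ?thesis using laws(3)[of 0 A] 3 by simp
  next
    case 4
    then show ?thesis using laws(4)[of 1] len by simp
  next
    case (5 q)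
    then obtain A B where "is = [A, B]"
      using len by (auto simp: numeral_2_eq_2 length_Suc_conv)
    then show ?thesis using laws(5)[of q A B] neg[of q] 5 by simp
  next
    case (6 q)
    then obtain A where "is = [A]"
      using len by (auto simp: length_Suc_conv)
    then show ?thesis using laws(6)[of q A] neg[of q] 6 by simp
  next
    case (7 q)
    then show ?thesis using laws(7)[of q] neg0[of q] len by simp
  qed
qed

text \<open>Every summand of the index sum scales by the same power of a, whose exponent is the
  total boost weight 0.\<close>

lemma monomial_val_rescaling:
  fixes F F' :: "('n::{finite,linorder}) fields"
  assumes tr: "transformation_laws a F F'" and x: "x \<in> on_C F" and pos: "a x > 0"
    and sc: "is_scalar CARD('n) t" and hkr: "boost_weight t = 0" "dimension t = 4" "quadratic_form t"
  shows "monomial_val Lam V F' (0, 0, x) t = monomial_val Lam V F (0, 0, x) t"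
proof -
  let ?c = "(0, 0, x) :: 'n pt"
  obtain cs T1 ls1 T2 ls2 Q where t: "t = (cs, (T1, ls1) # (T2, ls2) # Q)"
    and "T1 \<in> Pterms 0 0" "T2 \<in> Pterms 0 0" "\<And>f. f \<in> set Q \<Longrightarrow> excess (fst f) = 0"
    using hkr_dimension_4[OF hkr(1,3,2)] by metis
  then have T: "fst f \<in> Pterms 0 0 \<or> excess (fst f) = 0" if "f \<in> set (snd t)" for f
    using that by (metis fst_conv set_ConsD snd_conv)
  have len: "length ls = rank CARD('n) T" if "(T, ls) \<in> set (snd t)" for T ls
    using sc that by (auto simp: is_scalar_def)
  \<comment> \<open>Stated for lists of factors drawn from t, so that the excess and rank conditions
    survive the induction.\<close>
  have scale: "factor_prod F' ?c \<tau> fs = a x powi (\<Sum>f\<leftarrow>fs. boost (fst f)) * factor_prod F ?c \<tau> fs"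
    if "set fs \<subseteq> set (snd t)" for fs \<tau>
    using that
  proof (induction fs)
    case (Cons f fs)
    obtain S ls where f: "f = (S, ls)" by fastforce
    have "component F' S (map \<tau> ls) ?c = a x powi boost S * component F S (map \<tau> ls) ?c"
      using Cons.prems T[of f] len[of S ls] by (intro component_rescaling[OF tr x pos]) (auto simp: f)
    then show ?case
      using Cons pos by (simp add: f power_int_add)
  qed (simp add: factor_prod_def)
  \<comment> \<open>The couplings depend on the fields only through \<phi>.\<close>
  have "phi F' ?c = phi F ?c"
    using component_rescaling[OF tr x pos, of "PhiV 0 0" "[]"] by (simp add: excess_def scal_def)
  moreover have "factor_prod F' ?c \<tau> (snd t) = factor_prod F ?c \<tau> (snd t)" for \<tau>
    using scale[of "snd t" \<tau>] hkr(1) by (simp add: boost_weight_def)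
  ultimately show ?thesis
    by (cases t) (simp add: monomial_val_factor_prod)
qed

section \<open>Assembly of the orders in l\<close>

lemma hkr_expression_Nil:
  assumes "hkr_expression m n E" "n \<le> 3"
  shows "E = []"
  using assms hkr_dimension_ge_4 unfolding hkr_expression_def
  by (cases E) fastforce+

lemma expression_val_rescaling:
  fixes F F' :: "('n::{finite,linorder}) fields"
  assumes hkr: "hkr_expression CARD('n) n E" and n: "n \<le> 4"
    and F: "rescaling a F F'" "x \<in> on_C F"
  shows "expression_val Lam V E F' (0, 0, x) = expression_val Lam V E F (0, 0, x)"
proof (cases "n = 4")
  case True
  have "monomial_val Lam V F' (0, 0, x) t = monomial_val Lam V F (0, 0, x) t" if "t \<in> set E" for t
    using that hkr F True unfolding hkr_expression_def rescaling_def
    by (intro monomial_val_rescaling) auto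
  then show ?thesis
    unfolding expression_val_def by (metis (no_types, lifting) map_cong)
next
  case False
  then have "E = []"
    using hkr_expression_Nil[OF hkr] n by simp
  then show ?thesis
    by (simp add: expression_val_def)
qed

theorem mainTheorem9:
  fixes Lam :: real and V :: "real \<Rightarrow> real"
    and N :: nat and \<sigma> :: "nat \<Rightarrow> expression"
    and S :: "('n::{finite,linorder}) fields set"
    and s_IWW :: "real \<Rightarrow> 'n fields \<Rightarrow> 'n pt \<Rightarrow> real"
  assumes hkr: "\<And>n. n < N \<Longrightarrow> hkr_expression CARD('n) n (\<sigma> n)"
  shows "(\<forall>n<N. n \<le> 3 \<longrightarrow>
            (\<forall>(F :: 'n fields) p. gnc F \<longrightarrow> p \<in> on_horizon F \<longrightarrow>
               expression_val Lam V (\<sigma> n) F p = 0))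
       \<and> (4 < N \<longrightarrow>
            (\<exists>E. (\<forall>t\<in>set E. order4_form CARD('n) t) \<and>
               (\<forall>(F :: 'n fields) p. gnc F \<longrightarrow> p \<in> on_horizon F \<longrightarrow>
                  expression_val Lam V (\<sigma> 4) F p = expression_val Lam V E F p)))
       \<and> (\<forall>n<N. n \<le> 4 \<longrightarrow>
            gauge_invariant_on_C (UNIV :: 'n fields set) (expression_val Lam V (\<sigma> n)))
       \<and> (\<forall>l>0. gauge_invariant_on_C S (s_IWW l) \<longrightarrow>
            gauge_invariant_on_C S
              (\<lambda>F p. s_IWW l F p + hkr_correction Lam V \<sigma> (min N 5) l F p))
       \<and> ((\<forall>l>0. gauge_invariant_on_C S (s_IWW l)) \<longrightarrow>
            gauge_invariant_up_to 4 S
              (\<lambda>l F p. s_IWW l F p + hkr_correction Lam V \<sigma> N l F p))"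
proof -
  have part1: "expression_val Lam V (\<sigma> n) F p = 0" if "n < N" "n \<le> 3" for n and F :: "'n fields" and p
    using hkr_expression_Nil[OF hkr[OF that(1)] that(2)] by (simp add: expression_val_def)
  have part2: "\<exists>E. (\<forall>t\<in>set E. order4_form CARD('n) t) \<and>
      (\<forall>(F :: 'n fields) p. gnc F \<longrightarrow> p \<in> on_horizon F \<longrightarrow>
        expression_val Lam V (\<sigma> 4) F p = expression_val Lam V E F p)" if "4 < N"
  proof -
    have "\<forall>t\<in>set (\<sigma> 4). \<exists>t'. order4_form CARD('n) t' \<and>
      (\<forall>Lam V (F :: 'n fields) p. gnc F \<longrightarrow> p \<in> region F \<longrightarrow>
        monomial_val Lam V F p t' = monomial_val Lam V F p t)"
      using hkr[OF that] unfolding hkr_expression_def by (intro ballI order4_form_exists) auto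
    then obtain g where g: "\<forall>t\<in>set (\<sigma> 4). order4_form CARD('n) (g t) \<and>
      (\<forall>Lam V (F :: 'n fields) p. gnc F \<longrightarrow> p \<in> region F \<longrightarrow>
        monomial_val Lam V F p (g t) = monomial_val Lam V F p t)"
      \<comment> \<open>The choice of one normal form per monomial yields a function to be mapped
        over the expression.\<close>
      by metis
    have "expression_val Lam V (\<sigma> 4) F p = expression_val Lam V (map g (\<sigma> 4)) F p"
      if "gnc F" "p \<in> on_horizon F" for F :: "'n fields" and p
    proof -
      have "p \<in> region F"
        using that by (simp add: on_horizon_def)
      then show ?thesis
        unfolding expression_val_def map_map o_def
        using g that(1) by (intro arg_cong[of _ _ sum_list] map_cong refl) metis
    qed
    with g show ?thesis
      by (intro exI[of _ "map g (\<sigma> 4)"]) auto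
  qed
  have inv: "expression_val Lam V (\<sigma> n) F' (0, 0, x) = expression_val Lam V (\<sigma> n) F (0, 0, x)"
    if "n < N" "n \<le> 4" "rescaling a F F'" "x \<in> on_C F" for n a x and F F' :: "'n fields"
    using expression_val_rescaling[OF hkr] that by blast
  \<comment> \<open>\<open>min N 5\<close> cuts the sum off after order 4, so invariance applies to
    each summand.\<close>
  have corr: "hkr_correction Lam V \<sigma> (min N 5) l F' (0, 0, x) = hkr_correction Lam V \<sigma> (min N 5) l F (0, 0, x)"
    if "rescaling a F F'" "x \<in> on_C F" for l a x and F F' :: "'n fields"
    unfolding hkr_correction_def using inv that by (intro sum.cong) auto
  have part5: "(\<lambda>l. (s_IWW l F' (0, 0, x) + hkr_correction Lam V \<sigma> N l F' (0, 0, x))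
      - (s_IWW l F (0, 0, x) + hkr_correction Lam V \<sigma> N l F (0, 0, x))) \<in> O[at_right 0](\<lambda>l. l ^ (4 + 1))"
    if s: "\<forall>l>0. gauge_invariant_on_C S (s_IWW l)" and F: "F \<in> S" "F' \<in> S" "rescaling a F F'" "x \<in> on_C F"
    for a x and F F' :: "'n fields"
  proof -
    let ?e = "\<lambda>n. expression_val Lam V (\<sigma> n) F' (0, 0, x) - expression_val Lam V (\<sigma> n) F (0, 0, x)"
    have "s_IWW l F' (0, 0, x) = s_IWW l F (0, 0, x)" if "l > 0" for l
      using s F that unfolding gauge_invariant_on_C_def by blast
    \<comment> \<open>Only positive l matter at \<open>at_right 0\<close>; there the Iyer-Wald-Wall
      parts cancel and a polynomial in l with coefficients \<open>?e n\<close> remains.\<close>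
    then have ev: "\<forall>\<^sub>F l in at_right 0. (s_IWW l F' (0, 0, x) + hkr_correction Lam V \<sigma> N l F' (0, 0, x))
        - (s_IWW l F (0, 0, x) + hkr_correction Lam V \<sigma> N l F (0, 0, x)) = (\<Sum>n<N. ?e n * l ^ n)"
      by (intro eventually_at_rightI[of 0 1])
        (auto simp: hkr_correction_def sum_subtractf[symmetric] algebra_simps)
    have "(\<lambda>l. ?e n * l ^ n) \<in> O[at_right 0](\<lambda>l. l ^ (4 + 1))" if "n < N" for n
    proof (cases "n \<le> 4")
      case True
      then show ?thesis
        using inv[OF that True F(3,4)] by simp
    next
      case False
      \<comment> \<open>Here n is at least 5, and powers decrease in the exponent for 0 < l <
        1.\<close>
      have "(\<lambda>l::real. l ^ n) \<in> O[at_right 0](\<lambda>l. l ^ (4 + 1))"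
      proof (rule bigoI[of _ 1], rule eventually_at_rightI[of 0 1])
        fix l :: real assume "l \<in> {0<..<1}"
        then show "norm (l ^ n) \<le> 1 * norm (l ^ (4 + 1))"
          using False by (simp add: power_decreasing)
      qed simp
      then show ?thesis
        by (cases "?e n = 0") auto
    qed
    then have "(\<lambda>l. \<Sum>n<N. ?e n * l ^ n) \<in> O[at_right 0](\<lambda>l. l ^ (4 + 1))"
      by (intro big_sum_in_bigo) auto
    then show ?thesis
      using landau_o.big.in_cong[OF ev] by blast
  qed
  have part3: "\<forall>n<N. n \<le> 4 \<longrightarrow> gauge_invariant_on_C (UNIV :: 'n fields set) (expression_val Lam V (\<sigma> n))"
    unfolding gauge_invariant_on_C_def using inv by blast
  have part4: "\<forall>l>0. gauge_invariant_on_C S (s_IWW l) \<longrightarrow>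
      gauge_invariant_on_C S (\<lambda>F p. s_IWW l F p + hkr_correction Lam V \<sigma> (min N 5) l F p)"
    unfolding gauge_invariant_on_C_def using corr by metis
  show ?thesis
    using part1 part2 part3 part4 part5 unfolding gauge_invariant_up_to_def by blast
qed

end
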